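(* Let $a,b,c\ge 1$ be integers, let $T(a,b,c)$ be the T-shape tree consisting of a central vertex together with three pendant paths of lengths $a$, $b$ and $c$, and put $n=a+b+c+1$. Then $$P^\times_{T(a,b,c)}(z)=Az^n+Bz^{n-1}+Cz^{n-2},$$ where \begin{align*} A&=J_{a+b+2}J_{c+1}+2J_{a+1}J_{b+1}J_c,\\ B&=J_{a+b+1}J_{c+1}+2\bigl(J_aJ_{b+1}+J_{a+1}J_b\bigr)J_c,\\ C&=2J_aJ_bJ_c, \end{align*} and $J_k$ denotes the $k$th Jacobsthal number.
   Context: All graphs are finite, simple and undirected. For a graph $G=(V,E)$ with $V=\{v_1,\dots,v_n\}$ and a subset $L\subseteq V$, let $\mathbf{A}_{(G,L)}=(a_{ij})$ be the $n\times n$ matrix over $\mathrm{GF}(2)$ with $a_{ij}=1$ if $i\neq j$ and $v_iv_j\in E$, $a_{ii}=1$ if $v_i\in L$, and all other entries $0$. Its corank is $\operatorname{corank}(\mathbf{A}_{(G,L)})=n-\operatorname{rank}(\mathbf{A}_{(G,L)})$, the rank being taken over $\mathrm{GF}(2)$. The partial Petrial polynomial of $G$ is the integer polynomial $$P_G^\times(z)=\sum_{L\subseteq V} z^{\,n-\operatorname{corank}(\mathbf{A}_{(G,L)})}.$$ The length of a path is its number of edges; $T(a,b,c)$ is obtained by attaching three pendant paths with $a$, $b$, $c$ edges respectively to a central vertex (each path has one endpoint at the central vertex), so it has $a+b+c+1$ vertices. The Jacobsthal numbers are defined by $J_0=0$, $J_1=1$, $J_k=J_{k-1}+2J_{k-2}$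 for $k\ge2$; equivalently $J_k=\frac{2^k-(-1)^k}{3}$ for $k\ge 0$. *)

theory Defs
  imports
    "Graph_Theory.Pair_Digraph"
    "Jordan_Normal_Form.DL_Rank"
    "HOL-Library.Z2"
    "HOL-Computational_Algebra.Polynomial"
begin

text \<open>
  A finite simple undirected graph is a symmetric, loop-free, finite pair digraph
  (locale \<^locale>\<open>pair_graph\<close>): an undirected edge is a pair of opposite arcs.
  The rows and columns of its matrices are indexed along a list \<open>vs\<close> which enumerates the
  vertices; \<^typ>\<open>bit\<close> is the field with two elements.
\<close>

definition vertex_enum :: "'a list \<Rightarrow> 'a pair_pre_digraph \<Rightarrow> bool" where
  "vertex_enum vs G \<longleftrightarrow> distinct vs \<and> set vs = pverts G"

definition looped_adj_mat :: "'a list \<Rightarrow> 'a pair_pre_digraph \<Rightarrow> 'a set \<Rightarrow> bit mat" where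
  "looped_adj_mat vs G L = mat (length vs) (length vs) (\<lambda>(i, j).
     if i \<noteq> j \<and> (vs ! i, vs ! j) \<in> parcs G \<or> i = j \<and> vs ! i \<in> L then 1 else 0)"

definition corank :: "'k::field mat \<Rightarrow> nat" where
  "corank A = dim_col A - vec_space.rank (dim_row A) A"

definition partial_petrial_poly :: "'a list \<Rightarrow> 'a pair_pre_digraph \<Rightarrow> int poly" where
  "partial_petrial_poly vs G =
     (\<Sum>L\<in>Pow (pverts G). monom 1 (length vs - corank (looped_adj_mat vs G L)))"

text \<open>
  The three paths of \<open>T(a,b,c)\<close> are numbered 0, 1, 2, and \<open>path_vertex i k\<close> is the vertex of
  path \<open>i\<close> at distance \<open>k\<close> from the central vertex \<open>(0, 0)\<close>, which all three paths share.
\<close>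

definition path_vertex :: "nat \<Rightarrow> nat \<Rightarrow> nat \<times> nat" where
  "path_vertex i k = (if k = 0 then (0, 0) else (i, k))"

definition T_shape :: "nat \<Rightarrow> nat \<Rightarrow> nat \<Rightarrow> (nat \<times> nat) pair_pre_digraph" where
  "T_shape a b c =
     (let len = (\<lambda>i. [a, b, c] ! i);
          E = {(path_vertex i k, path_vertex i (Suc k)) |i k. i < 3 \<and> k < len i}
      in \<lparr> pverts = {path_vertex i k |i k. i < 3 \<and> k \<le> len i}, parcs = E \<union> E\<inverse> \<rparr>)"

fun jacobsthal :: "nat \<Rightarrow> int" where
  "jacobsthal 0 = 0"
| "jacobsthal (Suc 0) = 1"
| "jacobsthal (Suc (Suc k)) = jacobsthal (Suc k) + 2 * jacobsthal k"

lemma pverts_T_shape: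
  "pverts (T_shape a b c) =
     insert (0, 0) (Pair 0 ` {1..a} \<union> Pair 1 ` {1..b} \<union> Pair 2 ` {1..c})"
proof -
  have *: "(i < 3 \<and> k \<le> [a, b, c] ! i) \<longleftrightarrow>
      (i = 0 \<and> k \<le> a) \<or> (i = 1 \<and> k \<le> b) \<or> (i = 2 \<and> k \<le> c)" for i k :: nat
    by (auto simp: less_Suc_eq numeral_3_eq_3 numeral_2_eq_2)
  have "pverts (T_shape a b c) =
      path_vertex 0 ` {..a} \<union> path_vertex 1 ` {..b} \<union> path_vertex 2 ` {..c}"
    unfolding T_shape_def Let_def pair_pre_digraph.simps * by blast
  moreover have "path_vertex i ` {..l} = insert (0, 0) (Pair i ` {1..l})" for i l
  proof -
    have "{..l} = insert 0 {1..l}"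
      by auto
    moreover have "path_vertex i ` {1..l} = Pair i ` {1..l}"
      by (intro image_cong) (auto simp: path_vertex_def)
    moreover have "path_vertex i 0 = (0, 0)"
      by (simp add: path_vertex_def)
    ultimately show ?thesis
      by (simp only: image_insert)
  qed
  ultimately show ?thesis
    by auto
qed

lemma card_pverts_T_shape: "card (pverts (T_shape a b c)) = a + b + c + 1"
proof -
  have "card (Pair 0 ` {1..a} \<union> Pair 1 ` {1..b} \<union> Pair (2::nat) ` {1..c}) = a + b + c"
    by (subst card_Un_disjoint; (subst card_Un_disjoint)?) (auto simp: card_image inj_on_def)
  then show ?thesis
    unfolding pverts_T_shape by (subst card_insert_disjoint) auto
qed

lemma parcs_T_shape:
  "(u, v) \<in> parcs (T_shape a b c) \<longleftrightarrow> (\<exists>i k. i < 3 \<and> k < [a, b, c] ! i \<and>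
     (u = path_vertex i k \<and> v = path_vertex i (Suc k) \<or>
      v = path_vertex i k \<and> u = path_vertex i (Suc k)))"
  unfolding T_shape_def Let_def pair_pre_digraph.simps by blast

lemma pair_graph_T_shape: "pair_graph (T_shape a b c)"
proof -
  have vert: "path_vertex i k \<in> pverts (T_shape a b c)" if "i < 3" "k \<le> [a, b, c] ! i" for i k
    using that unfolding T_shape_def Let_def pair_pre_digraph.simps by blast
  have sub: "u \<in> pverts (T_shape a b c) \<and> v \<in> pverts (T_shape a b c)"
    if "(u, v) \<in> parcs (T_shape a b c)" for u v
    using that vert less_imp_le Suc_leI unfolding parcs_T_shape by blast
  have fin: "finite (pverts (T_shape a b c))"
    unfolding pverts_T_shape by simp
  have "parcs (T_shape a b c) \<subseteq> pverts (T_shape a b c) \<times> pverts (T_shape a b c)"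
    using sub by auto
  then have fin_arcs: "finite (parcs (T_shape a b c))"
    using fin finite_subset by blast
  have sym: "sym (parcs (T_shape a b c))"
    unfolding sym_def parcs_T_shape by blast
  have loopfree: "u \<noteq> v" if "(u, v) \<in> parcs (T_shape a b c)" for u v
    using that unfolding parcs_T_shape by (auto simp: path_vertex_def split: if_splits)
  show ?thesis
  proof unfold_locales
    fix e
    assume e: "e \<in> parcs (T_shape a b c)"
    show "fst e \<in> pverts (T_shape a b c)" "snd e \<in> pverts (T_shape a b c)" "fst e \<noteq> snd e"
      using e sub[of "fst e" "snd e"] loopfree[of "fst e" "snd e"] by auto
  qed (use fin fin_arcs sym in \<open>auto simp: symmetric_def\<close>)
qed

end

theory Submission
  imports Defs "Jordan_Normal_Form.Matrix_Kernel"
begin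

text \<open>
  Over the field with two elements a matrix with corank \<open>k\<close> has exactly \<open>2\<^sup>k\<close> kernel vectors
  (\<open>card_mat_kernel\<close>), so the coranks can be found by solving the kernel equations on the tree: at
  every vertex, the labels of the neighbours, and the label of the vertex itself if it carries a loop,
  add up to \<open>0\<close>.

  On an arm, the label \<open>t\<close> of the leaf determines all other labels. They are the multiples by \<open>t\<close> of a
  sequence of continuants, which depends only on the loops on that arm (\<open>arm_equations\<close>). Let \<open>p\<close> be
  the last member of that sequence, the value that the arm imposes on the centre when \<open>t = 1\<close>. The
  three arms have to agree at the centre, and the equation at the centre has to hold. With \<open>m\<close> the
  number of arms for which \<open>p = 0\<close>, this gives (\<open>corank_T_shape\<close>):

  \<^item> if \<open>m = 0\<close>, the corank is \<open>0\<close> or \<open>1\<close>, and the loop at the centre switches between the two;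

  \<^item> if \<open>m > 0\<close>, the corank is \<open>m - 1\<close>, with or without a loop at the centre.

  An arm of length \<open>l\<close> has \<open>J\<^sub>l\<close> loop sets with \<open>p = 0\<close> and \<open>J\<^bsub>l+1\<^esub>\<close> loop sets with \<open>p = 1\<close>
  (\<open>sum_continuant\<close>), and the loop sets on the arms are independent (\<open>sum_Pow_T_shape\<close>). Summation
  over the eight cases gives the coefficients
  \<open>J\<^bsub>a+1\<^esub> J\<^bsub>b+1\<^esub> J\<^bsub>c+1\<^esub> + 2 (J\<^sub>a J\<^bsub>b+1\<^esub> J\<^bsub>c+1\<^esub> + J\<^bsub>a+1\<^esub> J\<^sub>b J\<^bsub>c+1\<^esub> + J\<^bsub>a+1\<^esub> J\<^bsub>b+1\<^esub> J\<^sub>c)\<close>,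
  \<open>J\<^bsub>a+1\<^esub> J\<^bsub>b+1\<^esub> J\<^bsub>c+1\<^esub> + 2 (J\<^sub>a J\<^sub>b J\<^bsub>c+1\<^esub> + J\<^sub>a J\<^bsub>b+1\<^esub> J\<^sub>c + J\<^bsub>a+1\<^esub> J\<^sub>b J\<^sub>c)\<close> and
  \<open>2 J\<^sub>a J\<^sub>b J\<^sub>c\<close>, which the addition formula \<open>jacobsthal_add\<close> brings into the stated form.
\<close>

section \<open>Corank and the number of kernel vectors\<close>

lemma (in vec_space) span_cols_eq_range:
  assumes A: "A \<in> carrier_mat n nc"
  shows "span (set (cols A)) = (\<lambda>v. A *\<^sub>v v) ` carrier_vec nc"
proof -
  have cols: "set (cols A) \<subseteq> carrier_vec n"
    using A cols_dim by blast
  have "span (set (cols A)) = range (\<lambda>f. A *\<^sub>v vec nc f)"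
  proof -
    have "lincomb_list c (cols A) = A *\<^sub>v vec nc c" for c
    proof -
      have "\<forall>w\<in>set (cols A). dim_vec w = n"
        using cols by auto
      moreover have "mat_of_cols n (cols A) = A"
        using A by auto
      ultimately show ?thesis
        using lincomb_list_as_mat_mult[of "cols A" c] A by simp
    qed
    then show ?thesis
      unfolding span_list_as_span[OF cols, symmetric] span_list_def by auto
  qed
  also have "range (\<lambda>f. A *\<^sub>v vec nc f) = (\<lambda>v. A *\<^sub>v v) ` range (vec nc)"
    by (simp add: image_image)
  also have "range (vec nc) = (carrier_vec nc :: 'a vec set)"
  proof -
    have "v \<in> range (vec nc)" if "v \<in> carrier_vec nc" for v :: "'a vec"
      using that by (intro image_eqI[of _ _ "\<lambda>i. v $ i"]) auto
    then show ?thesis by auto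
  qed
  finally show ?thesis .
qed

text \<open>
  The rank of a matrix is the dimension of the span of its columns, and this span is the image of
  the linear map \<open>v \<mapsto> A v\<close>, so the rank-nullity theorem applies.
\<close>
lemma rank_plus_kernel_dim:
  fixes A :: "'a::field mat"
  assumes A: "A \<in> carrier_mat nr nc"
  shows "vec_space.rank nr A + kernel.dim nc A = nc"
proof -
  interpret V: vec_space "TYPE('a)" nc .
  interpret W: vec_space "TYPE('a)" nr .
  interpret T: linear_map class_ring V.V W.V "\<lambda>v. A *\<^sub>v v"
    using A mult_add_distrib_mat_vec[OF A] mult_mat_vec[OF A]
    by unfold_locales (auto simp: module_hom_def class_ring_simps)
  have "T.imT = W.span (set (cols A))"
    unfolding T.im_def W.span_cols_eq_range[OF A] by simp
  moreover have "T.kerT = mat_kernel A"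
    unfolding T.ker_def mat_kernel[OF A] by simp
  ultimately show ?thesis
    using T.rank_nullity[OF V.fin_dim] by (simp add: W.rank_def V.dim_is_n)
qed

lemma corank_eq_kernel_dim:
  assumes "A \<in> carrier_mat nr nc"
  shows "corank A = kernel.dim nc A"
  using rank_plus_kernel_dim[OF assms] assms unfolding corank_def by auto

text \<open>
  Coordinates with respect to a basis identify the kernel with the functions from the basis to the
  field. Over a finite field the corank can therefore be read off by counting solutions, without
  any elimination.
\<close>
lemma card_mat_kernel:
  fixes A :: "'a::field mat"
  assumes A: "A \<in> carrier_mat nr nc"
  shows "card (mat_kernel A) = card (UNIV :: 'a set) ^ corank A"
proof -
  interpret K: kernel nr nc A
    using A by unfold_locales
  obtain B where B: "finite B" "K.basis B"
    using kernel_basis_exists[OF A] by blast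
  have sub: "B \<subseteq> mat_kernel A"
    using B unfolding K.Ker.basis_def by simp
  have unique: "\<forall>v. v \<in> mat_kernel A \<longrightarrow> (\<exists>!a. a \<in> B \<rightarrow>\<^sub>E UNIV \<and> K.lincomb a B = v)"
    using K.Ker.basis_criterion[OF B(1)] B(2) sub by simp
  have "bij_betw (\<lambda>a. K.lincomb a B) (B \<rightarrow>\<^sub>E UNIV) (mat_kernel A)"
    unfolding bij_betw_def
  proof
    have closed: "K.lincomb a B \<in> mat_kernel A" for a
      using sub by (intro K.Ker.lincomb_closed) auto
    show "inj_on (\<lambda>a. K.lincomb a B) (B \<rightarrow>\<^sub>E UNIV)"
      using unique closed by (intro inj_onI) metis
    show "(\<lambda>a. K.lincomb a B) ` (B \<rightarrow>\<^sub>E UNIV) = mat_kernel A"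
      using unique closed by auto
  qed
  then have "card (mat_kernel A) = card (B \<rightarrow>\<^sub>E (UNIV :: 'a set))"
    by (metis bij_betw_same_card)
  also have "\<dots> = card (UNIV :: 'a set) ^ card B"
    using B(1) by (simp add: card_PiE)
  also have "card B = corank A"
    using K.Ker.dim_basis[OF B] corank_eq_kernel_dim[OF A] by simp
  finally show ?thesis .
qed

section \<open>The kernel of a looped graph\<close>

lemma UNIV_bit: "(UNIV :: bit set) = {0, 1}"
  by (auto intro: bit.exhaust)

lemma card_bit: "card (UNIV :: bit set) = 2"
  by (simp add: UNIV_bit)

text \<open>
  The kernel of the looped adjacency matrix, as a set of labellings of the vertices. It does not
  mention an enumeration of the vertices; the labellings are extensional so that they can be counted.
\<close>
definition looped_kernel :: "'a pair_pre_digraph \<Rightarrow> 'a set \<Rightarrow> ('a \<Rightarrow> bit) set" where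
  "looped_kernel G L = {x \<in> extensional (pverts G). \<forall>v\<in>pverts G.
     of_bool (v \<in> L) * x v + (\<Sum>u | (v, u) \<in> parcs G. x u) = 0}"

lemma card_looped_kernel:
  assumes "pair_loopfree_digraph G" and enum: "vertex_enum vs G"
  shows "card (looped_kernel G L) = 2 ^ corank (looped_adj_mat vs G L)"
proof -
  have loopfree: "(v, v) \<notin> parcs G" for v
    using pair_loopfree_digraph.no_loops'[OF assms(1), of v v] by blast
  have head_vert: "u \<in> pverts G" if "(v, u) \<in> parcs G" for u v
    using pair_loopfree_digraph.axioms(1)[OF assms(1)] pair_wf_digraph.in_arcsD2 that by metis
  have fin: "finite (pverts G)"
    using enum unfolding vertex_enum_def by (metis List.finite_set)
  define n where "n = length vs"
  define M where "M = looped_adj_mat vs G L"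
  have vs: "distinct vs" "set vs = pverts G"
    using enum by (auto simp: vertex_enum_def)
  have M: "M \<in> carrier_mat n n"
    by (simp add: M_def looped_adj_mat_def n_def)
  have nth_bij: "bij_betw ((!) vs) {..<n} (pverts G)"
    using vs by (intro bij_betw_nth) (auto simp: n_def)
  have row_eq: "(M *\<^sub>v vec n (\<lambda>j. x (vs ! j))) $ i
      = of_bool (vs ! i \<in> L) * x (vs ! i) + (\<Sum>u | (vs ! i, u) \<in> parcs G. x u)"
    if "i < n" for i and x :: "'a \<Rightarrow> bit"
  proof -
    define v where "v = vs ! i"
    have v: "v \<in> pverts G"
      using nth_mem[of i vs] \<open>i < n\<close> vs(2) by (simp add: v_def n_def)
    have entry: "M $$ (i, j) = of_bool (v = vs ! j) * of_bool (v \<in> L) + of_bool ((v, vs ! j) \<in> parcs G)"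
      if j: "j < n" for j
    proof (cases "i = j")
      case True
      then show ?thesis
        using loopfree j by (simp add: M_def looped_adj_mat_def n_def v_def)
    next
      case False
      then have "v \<noteq> vs ! j"
        using vs(1) j \<open>i < n\<close> by (simp add: v_def n_def nth_eq_iff_index_eq)
      then show ?thesis
        using False j \<open>i < n\<close> by (simp add: M_def looped_adj_mat_def n_def v_def)
    qed
    have "(M *\<^sub>v vec n (\<lambda>j. x (vs ! j))) $ i = (\<Sum>j<n. M $$ (i, j) * x (vs ! j))"
      using that M by (simp add: scalar_prod_def atLeast0LessThan)
    also have "\<dots> = (\<Sum>j<n. (of_bool (v = vs ! j) * of_bool (v \<in> L)
        + of_bool ((v, vs ! j) \<in> parcs G)) * x (vs ! j))"
      by (intro sum.cong) (simp_all only: entry lessThan_iff)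
    also have "\<dots> = (\<Sum>u\<in>pverts G. (of_bool (v = u) * of_bool (v \<in> L)
        + of_bool ((v, u) \<in> parcs G)) * x u)"
      by (rule sum.reindex_bij_betw[OF nth_bij])
    also have "\<dots> = (\<Sum>u\<in>pverts G. if v = u then of_bool (v \<in> L) * x u else 0)
        + (\<Sum>u\<in>pverts G. if (v, u) \<in> parcs G then x u else 0)"
      unfolding sum.distrib[symmetric] by (intro sum.cong) (simp_all add: loopfree)
    also have "(\<Sum>u\<in>pverts G. if v = u then of_bool (v \<in> L) * x u else 0) = of_bool (v \<in> L) * x v"
      using v fin by simp
    also have "(\<Sum>u\<in>pverts G. if (v, u) \<in> parcs G then x u else 0) = (\<Sum>u | (v, u) \<in> parcs G. x u)"
    proof -
      have "{u. (v, u) \<in> parcs G} = pverts G \<inter> {u. (v, u) \<in> parcs G}"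
        using head_vert by auto
      then show ?thesis
        using fin by (simp add: sum.If_cases)
    qed
    finally show ?thesis
      by (simp add: v_def)
  qed
  have ker_iff: "vec n (\<lambda>j. x (vs ! j)) \<in> mat_kernel M \<longleftrightarrow> x \<in> looped_kernel G L"
    if x: "x \<in> extensional (pverts G)" for x
  proof -
    have "vec n (\<lambda>j. x (vs ! j)) \<in> mat_kernel M \<longleftrightarrow>
        (\<forall>i<n. (M *\<^sub>v vec n (\<lambda>j. x (vs ! j))) $ i = 0)"
      unfolding mat_kernel[OF M] using M by (auto simp del: index_mult_mat_vec intro!: eq_vecI)
    also have "\<dots> \<longleftrightarrow> (\<forall>i<n. of_bool (vs ! i \<in> L) * x (vs ! i)
        + (\<Sum>u | (vs ! i, u) \<in> parcs G. x u) = 0)"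
      using row_eq by (auto simp del: index_mult_mat_vec)
    also have "\<dots> \<longleftrightarrow> (\<forall>v\<in>pverts G. of_bool (v \<in> L) * x v + (\<Sum>u | (v, u) \<in> parcs G. x u) = 0)"
      unfolding vs(2)[symmetric] n_def by (metis in_set_conv_nth)
    also have "\<dots> \<longleftrightarrow> x \<in> looped_kernel G L"
      using x by (simp add: looped_kernel_def)
    finally show ?thesis .
  qed
  have "bij_betw (\<lambda>x. vec n (\<lambda>j. x (vs ! j))) (looped_kernel G L) (mat_kernel M)"
    unfolding bij_betw_def
  proof
    show "inj_on (\<lambda>x. vec n (\<lambda>j. x (vs ! j))) (looped_kernel G L)"
    proof (rule inj_onI)
      fix x y :: "'a \<Rightarrow> bit"
      assume "x \<in> looped_kernel G L" "y \<in> looped_kernel G L"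
        and eq: "vec n (\<lambda>j. x (vs ! j)) = vec n (\<lambda>j. y (vs ! j))"
      then have "x \<in> extensional (pverts G)" "y \<in> extensional (pverts G)"
        by (auto simp: looped_kernel_def)
      moreover have "x (vs ! j) = y (vs ! j)" if "j < n" for j
        using arg_cong[OF eq, of "\<lambda>w. w $ j"] that by simp
      then have "x v = y v" if "v \<in> pverts G" for v
        using that unfolding vs(2)[symmetric] n_def by (metis in_set_conv_nth)
      ultimately show "x = y"
        by (rule extensionalityI)
    qed
    have "w \<in> (\<lambda>x. vec n (\<lambda>j. x (vs ! j))) ` looped_kernel G L" if w: "w \<in> mat_kernel M" for w
    proof -
      define x where "x = restrict (\<lambda>v. w $ the_inv_into {..<n} ((!) vs) v) (pverts G)"
      have inj: "inj_on ((!) vs) {..<n}"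
        using nth_bij by (rule bij_betw_imp_inj_on)
      have "x (vs ! j) = w $ j" if "j < n" for j
        using that vs the_inv_into_f_f[OF inj, of j] by (auto simp: x_def n_def)
      then have "vec n (\<lambda>j. x (vs ! j)) = w"
        using mat_kernelD[OF M w] by auto
      moreover have "x \<in> extensional (pverts G)"
        by (simp add: x_def)
      ultimately show ?thesis
        using ker_iff w by blast
    qed
    then show "(\<lambda>x. vec n (\<lambda>j. x (vs ! j))) ` looped_kernel G L = mat_kernel M"
      using ker_iff by (fastforce simp: looped_kernel_def)
  qed
  then have "card (looped_kernel G L) = card (mat_kernel M)"
    by (rule bij_betw_same_card)
  also have "\<dots> = 2 ^ corank M"
    by (simp add: card_mat_kernel[OF M] card_bit)
  finally show ?thesis
    by (simp add: M_def)
qed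

section \<open>Continuants and Jacobsthal numbers\<close>

text \<open>
  Number the vertices of a path from its outer end by \<open>1, 2, \<dots>\<close> and put loops at the vertices in
  \<open>D\<close>. The kernel equation at vertex \<open>j\<close> determines the label of vertex \<open>j + 1\<close> from those of \<open>j\<close>
  and \<open>j - 1\<close>; the continuant is the solution that has label \<open>1\<close> at the outer end.
  It is also the determinant of the looped adjacency matrix of the path on \<open>j - 1\<close> vertices.
\<close>
fun continuant :: "nat set \<Rightarrow> nat \<Rightarrow> bit" where
  "continuant D 0 = 0"
| "continuant D (Suc 0) = 1"
| "continuant D (Suc (Suc j)) = of_bool (Suc j \<in> D) * continuant D (Suc j) + continuant D j"

text \<open>
  Two consecutive zeros would propagate back to the initial value \<open>1\<close>.
\<close>
lemma continuant_Suc_ne_0: "continuant D j = 0 \<Longrightarrow> continuant D (Suc j) = 1"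
proof (induction j)
  case (Suc j)
  then show ?case
    by (cases "continuant D j") auto
qed simp

lemma continuant_pred_of_zero: "continuant D (Suc j) = 0 \<Longrightarrow> continuant D j = 1"
  using continuant_Suc_ne_0[of D j] by (cases "continuant D j") auto

lemma continuant_cong:
  "(\<And>i. 0 < i \<Longrightarrow> i < j \<Longrightarrow> i \<in> D \<longleftrightarrow> i \<in> D') \<Longrightarrow> continuant D j = continuant D' j"
  by (induction D j rule: continuant.induct) auto

lemma recurrence_iff_continuant:
  fixes w :: "nat \<Rightarrow> bit"
  assumes "w 0 = 0"
  shows "(\<forall>j\<in>{1..l}. w (Suc j) = of_bool (j \<in> D) * w j + w (j - 1))
    \<longleftrightarrow> (\<forall>j\<le>Suc l. w j = w 1 * continuant D j)"
proof
  assume rec: "\<forall>j\<in>{1..l}. w (Suc j) = of_bool (j \<in> D) * w j + w (j - 1)"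
  have "w j = w 1 * continuant D j" if "j \<le> Suc l" for j
    using that
  proof (induction j rule: induct_nat_012)
    case (ge2 j)
    then have "w (Suc (Suc j)) = of_bool (Suc j \<in> D) * w (Suc j) + w j"
    proof -
      have "Suc j \<in> {1..l}"
        using ge2.prems by simp
      from bspec[OF rec this] show ?thesis
        by (simp only: diff_Suc_1)
    qed
    moreover have "w (Suc j) = w 1 * continuant D (Suc j)" "w j = w 1 * continuant D j"
      using ge2 by (auto simp del: continuant.simps)
    ultimately show ?case
      by (simp only: continuant.simps distrib_left mult.left_commute)
  qed (simp_all add: assms)
  then show "\<forall>j\<le>Suc l. w j = w 1 * continuant D j"
    by blast
next
  assume sol: "\<forall>j\<le>Suc l. w j = w 1 * continuant D j"
  have "w (Suc j) = of_bool (j \<in> D) * w j + w (j - 1)" if "j \<in> {1..l}" for j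
  proof -
    obtain i where i: "j = Suc i"
      using \<open>j \<in> {1..l}\<close> by (cases j) auto
    have eq: "w m = w 1 * continuant D m" if "m \<le> Suc l" for m
      using sol that by blast
    have "Suc i \<le> l"
      using \<open>j \<in> {1..l}\<close> i by simp
    then have "w (Suc (Suc i)) = w 1 * continuant D (Suc (Suc i))"
      "w (Suc i) = w 1 * continuant D (Suc i)" "w i = w 1 * continuant D i"
      by (intro eq; linarith)+
    then show ?thesis
      unfolding i by (simp only: continuant.simps diff_Suc_1 distrib_left mult.left_commute)
  qed
  then show "\<forall>j\<in>{1..l}. w (Suc j) = of_bool (j \<in> D) * w j + w (j - 1)"
    by blast
qed

lemma sum_Pow_insert:
  assumes "x \<notin> A" "finite A"
  shows "(\<Sum>D\<in>Pow (insert x A). f D) = (\<Sum>D\<in>Pow A. f D + f (insert x D))"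
proof -
  have "inj_on (insert x) (Pow A)"
    using assms by (intro inj_onI) (metis PowD insert_ident subsetD)
  moreover have "Pow A \<inter> insert x ` Pow A = {}"
    using assms by auto
  ultimately show ?thesis
    using assms by (simp add: Pow_insert sum.union_disjoint sum.reindex sum.distrib)
qed

text \<open>
  Over all loop sets on a path with \<open>l\<close> vertices, the continuant at \<open>l + 1\<close> vanishes exactly
  \<open>J\<^sub>l\<close> times. If it vanishes after \<open>l\<close> vertices, then it is \<open>1\<close> after \<open>l + 1\<close> vertices, with or
  without a loop at the new vertex; if it does not vanish, exactly one of these two choices makes it
  vanish. Hence the two counts satisfy \<open>(z, w) \<mapsto> (w, w + 2 z)\<close>, which is the Jacobsthal recursion.
  The weight \<open>h\<close> is arbitrary so that the lemma can be applied to the three arms in turn.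
\<close>
lemma sum_continuant:
  fixes h :: "bool \<Rightarrow> 'r::comm_ring_1"
  shows "(\<Sum>D\<in>Pow {1..l}. h (continuant D (Suc l) = 0))
    = of_int (jacobsthal l) * h True + of_int (jacobsthal (Suc l)) * h False"
proof (induction l arbitrary: h)
  case 0
  then show ?case by simp
next
  case (Suc l)
  have step: "h (continuant D (Suc (Suc l)) = 0)
        + h (continuant (insert (Suc l) D) (Suc (Suc l)) = 0)
      = (if continuant D (Suc l) = 0 then 2 * h False else h True + h False)"
    if "D \<in> Pow {1..l}" for D
  proof -
    have "Suc l \<notin> D"
      using that by auto
    moreover have "continuant (insert (Suc l) D) j = continuant D j" if "j \<le> Suc l" for j
      using that by (intro continuant_cong) auto
    ultimately show ?thesis
      using continuant_Suc_ne_0[of D l]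
      by (cases "continuant D (Suc l)"; cases "continuant D l") (auto simp: algebra_simps)
  qed
  have "(\<Sum>D\<in>Pow {1..Suc l}. h (continuant D (Suc (Suc l)) = 0))
      = (\<Sum>D\<in>Pow {1..l}. h (continuant D (Suc (Suc l)) = 0)
          + h (continuant (insert (Suc l) D) (Suc (Suc l)) = 0))"
  proof -
    have "{1..Suc l} = insert (Suc l) {1..l}"
      by auto
    then show ?thesis
      by (simp only:) (rule sum_Pow_insert, auto)
  qed
  also have "\<dots> = (\<Sum>D\<in>Pow {1..l}. if continuant D (Suc l) = 0 then 2 * h False else h True + h False)"
    by (intro sum.cong refl step)
  also have "\<dots> = of_int (jacobsthal l) * (2 * h False)
      + of_int (jacobsthal (Suc l)) * (h True + h False)"
    using Suc.IH[of "\<lambda>b. if b then 2 * h False else h True + h False"] by simp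
  also have "\<dots> = of_int (jacobsthal (Suc l)) * h True + of_int (jacobsthal (Suc (Suc l))) * h False"
    by (simp add: algebra_simps)
  finally show ?case .
qed

lemma jacobsthal_add:
  "jacobsthal (Suc (m + k))
    = jacobsthal (Suc m) * jacobsthal (Suc k) + 2 * jacobsthal m * jacobsthal k"
proof (induction m arbitrary: k)
  case (Suc m)
  from Suc.IH[of "Suc k"] show ?case
    by (simp add: algebra_simps)
qed simp

section \<open>The kernel equations of the T-shape tree\<close>

lemma less_3_iff: "i < 3 \<longleftrightarrow> i = 0 \<or> i = 1 \<or> i = (2::nat)"
  by auto

lemma nbrs_center:
  assumes "a \<ge> 1" "b \<ge> 1" "c \<ge> 1"
  shows "{u. ((0, 0), u) \<in> parcs (T_shape a b c)} = {(0, 1), (1, 1), (2, 1)}"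
proof -
  have "u \<in> {(0, 1), (1, 1), (2, 1)}" if "((0, 0), u) \<in> parcs (T_shape a b c)" for u
    using that unfolding parcs_T_shape less_3_iff by (auto simp: path_vertex_def split: if_splits)
  moreover have "((0, 0), (i, 1)) \<in> parcs (T_shape a b c)" if "i < 3" for i
    unfolding parcs_T_shape using that assms
    by (intro exI[of _ i] exI[of _ 0]) (auto simp: path_vertex_def less_3_iff)
  ultimately show ?thesis
    by (auto simp: less_3_iff)
qed

lemma nbrs_arm:
  assumes "i < 3" "0 < k" "k \<le> [a, b, c] ! i"
  shows "{u. ((i, k), u) \<in> parcs (T_shape a b c)}
    = insert (path_vertex i (k - 1)) (if k < [a, b, c] ! i then {(i, Suc k)} else {})" (is "?L = ?R")
proof -
  have iff: "(i, k) = path_vertex i' k' \<longleftrightarrow> i' = i \<and> k' = k" for i' k'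
    using assms(2) by (auto simp: path_vertex_def)
  have "u \<in> ?L \<longleftrightarrow> k < [a, b, c] ! i \<and> u = path_vertex i (Suc k)
      \<or> (\<exists>k'. k = Suc k' \<and> u = path_vertex i k')" for u
    using assms unfolding mem_Collect_eq parcs_T_shape iff by (cases k) (auto simp: Suc_le_eq)
  also have "\<dots> u \<longleftrightarrow> u \<in> ?R" for u
    using assms(2) by (cases k) (auto simp: path_vertex_def)
  finally show ?thesis
    by blast
qed

text \<open>
  The loops on arm \<open>i\<close>, renumbered from the outer end of the arm: the continuant runs inwards,
  whereas the vertices of the tree are numbered by their distance from the centre.
\<close>
definition arm_loops :: "(nat \<times> nat) set \<Rightarrow> nat \<Rightarrow> nat \<Rightarrow> nat set" where
  "arm_loops L i l = {j \<in> {1..l}. (i, Suc l - j) \<in> L}"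

lemma bit_add_eq_0_iff: "u + (v + w) = 0 \<longleftrightarrow> v = u + w" for u v w :: bit
  by (cases u; cases v; cases w) auto

text \<open>
  On an arm, the kernel equations at the vertices other than the centre leave only the label of the
  outer end free: they propagate it inwards along the continuant, up to and including the centre.
\<close>
lemma arm_equations:
  fixes x :: "nat \<times> nat \<Rightarrow> bit"
  assumes i: "i < 3" and l: "l = [a, b, c] ! i"
  shows "(\<forall>k\<in>{1..l}. of_bool ((i, k) \<in> L) * x (i, k)
        + (\<Sum>u | ((i, k), u) \<in> parcs (T_shape a b c). x u) = 0)
    \<longleftrightarrow> (\<forall>k\<le>l. x (path_vertex i k)
        = x (path_vertex i l) * continuant (arm_loops L i l) (Suc l - k))"
proof -
  define D where "D = arm_loops L i l"
  \<comment> \<open>The labels read from the outer end; the value at 0 stands for the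
    missing neighbour beyond the leaf.\<close>
  define w where "w j = (if j = 0 then 0 else x (path_vertex i (Suc l - j)))" for j
  have local_eq: "of_bool ((i, k) \<in> L) * x (i, k)
        + (\<Sum>u | ((i, k), u) \<in> parcs (T_shape a b c). x u) = 0
      \<longleftrightarrow> w (Suc j) = of_bool (j \<in> D) * w j + w (j - 1)"
    if "k \<in> {1..l}" and j: "j = Suc l - k" for j k
  proof -
    have k: "0 < k" "k \<le> l"
      using \<open>k \<in> {1..l}\<close> by auto
    have loop: "j \<in> D \<longleftrightarrow> (i, k) \<in> L"
      using k by (auto simp: D_def arm_loops_def j)
    have w_here: "w j = x (i, k)"
      using k by (simp add: w_def j path_vertex_def)
    have w_in: "w (Suc j) = x (path_vertex i (k - 1))"
      using k by (simp add: w_def j Suc_diff_le)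
    have w_out: "w (j - 1) = (if k < l then x (i, Suc k) else 0)"
      using k by (simp add: w_def j path_vertex_def Suc_diff_Suc)
    have "path_vertex i (k - 1) \<noteq> (i, Suc k)"
      by (auto simp: path_vertex_def)
    then have "(\<Sum>u | ((i, k), u) \<in> parcs (T_shape a b c). x u) = w (Suc j) + w (j - 1)"
      unfolding nbrs_arm[OF i k(1) k(2)[unfolded l]] l[symmetric] w_in w_out by simp
    then show ?thesis
      by (simp only: w_here loop bit_add_eq_0_iff)
  qed
  have "(\<forall>k\<in>{1..l}. of_bool ((i, k) \<in> L) * x (i, k)
        + (\<Sum>u | ((i, k), u) \<in> parcs (T_shape a b c). x u) = 0)
      \<longleftrightarrow> (\<forall>j\<in>{1..l}. w (Suc j) = of_bool (j \<in> D) * w j + w (j - 1))"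
  proof (intro iffI ballI)
    fix j
    assume eqs: "\<forall>k\<in>{1..l}. of_bool ((i, k) \<in> L) * x (i, k)
        + (\<Sum>u | ((i, k), u) \<in> parcs (T_shape a b c). x u) = 0" and j: "j \<in> {1..l}"
    then have "Suc l - j \<in> {1..l}" "j = Suc l - (Suc l - j)"
      by auto
    then show "w (Suc j) = of_bool (j \<in> D) * w j + w (j - 1)"
      using local_eq bspec[OF eqs] by blast
  next
    fix k
    assume rec: "\<forall>j\<in>{1..l}. w (Suc j) = of_bool (j \<in> D) * w j + w (j - 1)" and k: "k \<in> {1..l}"
    then have "Suc l - k \<in> {1..l}"
      by auto
    then show "of_bool ((i, k) \<in> L) * x (i, k)
        + (\<Sum>u | ((i, k), u) \<in> parcs (T_shape a b c). x u) = 0"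
      using local_eq[OF k refl] bspec[OF rec] by blast
  qed
  also have "\<dots> \<longleftrightarrow> (\<forall>j\<le>Suc l. w j = w 1 * continuant D j)"
    by (rule recurrence_iff_continuant) (simp add: w_def)
  also have "\<dots> \<longleftrightarrow> (\<forall>k\<le>l. x (path_vertex i k) = x (path_vertex i l) * continuant D (Suc l - k))"
  proof
    assume sol: "\<forall>j\<le>Suc l. w j = w 1 * continuant D j"
    show "\<forall>k\<le>l. x (path_vertex i k) = x (path_vertex i l) * continuant D (Suc l - k)"
    proof (intro allI impI)
      fix k
      assume k: "k \<le> l"
      have "w (Suc l - k) = w 1 * continuant D (Suc l - k)"
        by (intro sol[rule_format]) simp
      moreover have "w (Suc l - k) = x (path_vertex i k)" "w 1 = x (path_vertex i l)"
        using k by (simp_all add: w_def)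
      ultimately show "x (path_vertex i k) = x (path_vertex i l) * continuant D (Suc l - k)"
        by (simp only:)
    qed
  next
    assume sol: "\<forall>k\<le>l. x (path_vertex i k) = x (path_vertex i l) * continuant D (Suc l - k)"
    show "\<forall>j\<le>Suc l. w j = w 1 * continuant D j"
    proof (intro allI impI)
      fix j
      assume j: "j \<le> Suc l"
      show "w j = w 1 * continuant D j"
      proof (cases "j = 0")
        case False
        then have "x (path_vertex i (Suc l - j))
            = x (path_vertex i l) * continuant D (Suc l - (Suc l - j))"
          by (intro sol[rule_format]) simp
        then show ?thesis
          using False j by (simp add: w_def)
      qed (simp add: w_def)
    qed
  qed
  finally show ?thesis
    by (simp only: D_def)
qed

lemma looped_kernel_T_shape_iff:
  assumes "a \<ge> 1" "b \<ge> 1" "c \<ge> 1"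
  shows "x \<in> looped_kernel (T_shape a b c) L \<longleftrightarrow>
    x \<in> extensional (pverts (T_shape a b c)) \<and>
    of_bool ((0, 0) \<in> L) * x (0, 0) + (x (0, 1) + (x (1, 1) + x (2, 1))) = 0 \<and>
    (\<forall>i<3. \<forall>k\<le>[a, b, c] ! i. x (path_vertex i k) = x (path_vertex i ([a, b, c] ! i))
      * continuant (arm_loops L i ([a, b, c] ! i)) (Suc ([a, b, c] ! i) - k))"
proof -
  let ?E = "\<lambda>v. of_bool (v \<in> L) * x v + (\<Sum>u | (v, u) \<in> parcs (T_shape a b c). x u) = 0"
  have "(\<forall>v\<in>pverts (T_shape a b c). ?E v)
      \<longleftrightarrow> ?E (0, 0) \<and> (\<forall>i<3. \<forall>k\<in>{1..[a, b, c] ! i}. ?E (i, k))"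
  proof -
    have "pverts (T_shape a b c) = insert (0, 0) (SIGMA i:{..<3}. {1..[a, b, c] ! i})"
      unfolding pverts_T_shape by (auto simp: less_3_iff)
    then show ?thesis
      by auto
  qed
  also have "(\<forall>i<3. \<forall>k\<in>{1..[a, b, c] ! i}. ?E (i, k))
      \<longleftrightarrow> (\<forall>i<3. \<forall>k\<le>[a, b, c] ! i. x (path_vertex i k) = x (path_vertex i ([a, b, c] ! i))
        * continuant (arm_loops L i ([a, b, c] ! i)) (Suc ([a, b, c] ! i) - k))"
    by (intro all_cong arm_equations refl)
  also have "?E (0, 0) \<longleftrightarrow> of_bool ((0, 0) \<in> L) * x (0, 0) + (x (0, 1) + (x (1, 1) + x (2, 1))) = 0"
    unfolding nbrs_center[OF assms] by simp
  finally show ?thesis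
    by (simp add: looped_kernel_def)
qed

text \<open>
  A kernel vector is determined by its labels \<open>t0\<close>, \<open>t1\<close>, \<open>t2\<close> at the three leaves. The conditions
  that remain say that the three arms agree on the label of the centre, and that the equation at the
  centre holds.
\<close>
lemma card_looped_kernel_T_shape:
  fixes L :: "(nat \<times> nat) set"
  assumes "a \<ge> 1" "b \<ge> 1" "c \<ge> 1"
  defines "D0 \<equiv> arm_loops L 0 a" and "D1 \<equiv> arm_loops L 1 b" and "D2 \<equiv> arm_loops L 2 c"
  defines "p0 \<equiv> continuant D0 (Suc a)" and "p1 \<equiv> continuant D1 (Suc b)" and "p2 \<equiv> continuant D2 (Suc c)"
  shows "card (looped_kernel (T_shape a b c) L) = card {(t0, t1, t2).
      t0 * p0 = t1 * p1 \<and> t0 * p0 = t2 * p2 \<and>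
      of_bool ((0, 0) \<in> L) * (t0 * p0)
        + (t0 * continuant D0 a + (t1 * continuant D1 b + t2 * continuant D2 c)) = 0}"
    (is "card ?K = card ?S")
proof -
  let ?V = "pverts (T_shape a b c)"
  let ?l = "\<lambda>i. [a, b, c] ! i"
  let ?tips = "\<lambda>x :: nat \<times> nat \<Rightarrow> bit. (x (0, a), x (1, b), x (2, c))"
  have arms: "(\<forall>i<3. \<forall>k\<le>?l i. x (path_vertex i k) = x (path_vertex i (?l i))
        * continuant (arm_loops L i (?l i)) (Suc (?l i) - k))
      \<longleftrightarrow> (\<forall>k\<le>a. x (path_vertex 0 k) = x (0, a) * continuant D0 (Suc a - k))
        \<and> (\<forall>k\<le>b. x (path_vertex 1 k) = x (1, b) * continuant D1 (Suc b - k))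
        \<and> (\<forall>k\<le>c. x (path_vertex 2 k) = x (2, c) * continuant D2 (Suc c - k))"
    for x :: "nat \<times> nat \<Rightarrow> bit"
  proof -
    have all3: "(\<forall>i<3. P i) \<longleftrightarrow> P 0 \<and> P 1 \<and> P (2::nat)" for P
      unfolding less_3_iff by blast
    have tip: "path_vertex 0 a = (0, a)" "path_vertex 1 b = (1, b)" "path_vertex 2 c = (2, c)"
      using assms(1-3) by (simp_all add: path_vertex_def)
    have len: "?l 0 = a" "?l 1 = b" "?l 2 = c"
      by simp_all
    show ?thesis
      unfolding all3 len tip D0_def D1_def D2_def by (rule refl)
  qed
  have verts: "v \<in> ?V \<longleftrightarrow> (\<exists>k\<le>a. v = path_vertex 0 k) \<or> (\<exists>k\<le>b. v = path_vertex 1 k)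
      \<or> (\<exists>k\<le>c. v = path_vertex 2 k)" for v
  proof -
    have ex3: "(\<exists>i<3. P i) \<longleftrightarrow> P 0 \<or> P 1 \<or> P (2::nat)" for P
      unfolding less_3_iff by blast
    have len: "?l 0 = a" "?l 1 = b" "?l 2 = c"
      by simp_all
    have "v \<in> ?V \<longleftrightarrow> (\<exists>i<3. \<exists>k\<le>?l i. v = path_vertex i k)"
      unfolding T_shape_def Let_def pair_pre_digraph.simps by blast
    then show ?thesis
      unfolding ex3 len .
  qed
  have center: "path_vertex i 0 = (0, 0)" and off_center: "0 < k \<Longrightarrow> path_vertex i k = (i, k)" for i k
    by (simp_all add: path_vertex_def)
  have first: "path_vertex i 1 = (i, 1)" for i
    by (simp add: path_vertex_def)
  have "bij_betw ?tips ?K ?S"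
    unfolding bij_betw_def
  proof
    show "inj_on ?tips ?K"
    proof (rule inj_onI)
      fix x y
      assume x: "x \<in> ?K" and y: "y \<in> ?K" and eq: "?tips x = ?tips y"
      have tips: "x (0, a) = y (0, a)" "x (1, b) = y (1, b)" "x (2, c) = y (2, c)"
        using eq by simp_all
      have X: "\<forall>k\<le>a. x (path_vertex 0 k) = x (0, a) * continuant D0 (Suc a - k)"
        "\<forall>k\<le>b. x (path_vertex 1 k) = x (1, b) * continuant D1 (Suc b - k)"
        "\<forall>k\<le>c. x (path_vertex 2 k) = x (2, c) * continuant D2 (Suc c - k)"
        using x unfolding looped_kernel_T_shape_iff[OF assms(1-3)] arms by blast+
      have Y: "\<forall>k\<le>a. y (path_vertex 0 k) = y (0, a) * continuant D0 (Suc a - k)"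
        "\<forall>k\<le>b. y (path_vertex 1 k) = y (1, b) * continuant D1 (Suc b - k)"
        "\<forall>k\<le>c. y (path_vertex 2 k) = y (2, c) * continuant D2 (Suc c - k)"
        using y unfolding looped_kernel_T_shape_iff[OF assms(1-3)] arms by blast+
      have "x v = y v" if "v \<in> ?V" for v
        using that X Y unfolding verts tips by metis
      moreover have "x \<in> extensional ?V" "y \<in> extensional ?V"
        using x y by (simp_all add: looped_kernel_def)
      ultimately show "x = y"
        by (intro extensionalityI)
    qed
    have "?tips x \<in> ?S" if "x \<in> ?K" for x
    proof -
      from that have X: "\<forall>k\<le>a. x (path_vertex 0 k) = x (0, a) * continuant D0 (Suc a - k)"
        "\<forall>k\<le>b. x (path_vertex 1 k) = x (1, b) * continuant D1 (Suc b - k)"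
        "\<forall>k\<le>c. x (path_vertex 2 k) = x (2, c) * continuant D2 (Suc c - k)"
        and C: "of_bool ((0, 0) \<in> L) * x (0, 0) + (x (0, 1) + (x (1, 1) + x (2, 1))) = 0"
        unfolding looped_kernel_T_shape_iff[OF assms(1-3)] arms by blast+
      have x0: "x (0, 0) = x (0, a) * p0" "x (0, 0) = x (1, b) * p1" "x (0, 0) = x (2, c) * p2"
        using X(1)[rule_format, of 0] X(2)[rule_format, of 0] X(3)[rule_format, of 0]
        unfolding center p0_def p1_def p2_def diff_zero by (simp_all only: le0)
      have x1: "x (0, 1) = x (0, a) * continuant D0 a" "x (1, 1) = x (1, b) * continuant D1 b"
        "x (2, 1) = x (2, c) * continuant D2 c"
        using X(1)[rule_format, of 1] X(2)[rule_format, of 1] X(3)[rule_format, of 1] assms(1-3)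
        unfolding first diff_Suc_1 by (simp_all only: One_nat_def diff_Suc_1)
      show ?thesis
        using C unfolding x1 mem_Collect_eq prod.case x0(1)[symmetric] x0(2)[symmetric] x0(3)[symmetric]
        by (intro conjI refl)
    qed
    moreover have "t \<in> ?tips ` ?K" if t_in: "t \<in> ?S" for t
    proof -
      obtain t0 t1 t2 where t: "t = (t0, t1, t2)"
        by (cases t) auto
      have e1: "t0 * p0 = t1 * p1" and e2: "t0 * p0 = t2 * p2"
        and C: "of_bool ((0, 0) \<in> L) * (t0 * p0)
          + (t0 * continuant D0 a + (t1 * continuant D1 b + t2 * continuant D2 c)) = 0"
        using t_in unfolding t mem_Collect_eq prod.case by blast+
      define y where "y = restrict (\<lambda>(i, k). [t0 * continuant D0 (Suc a - k),
          t1 * continuant D1 (Suc b - k), t2 * continuant D2 (Suc c - k)] ! i) ?V"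
      have y_center: "y (0, 0) = t0 * p0"
        unfolding y_def p0_def pverts_T_shape by simp
      have Y0: "\<forall>k\<le>a. y (path_vertex 0 k) = t0 * continuant D0 (Suc a - k)"
      proof (intro allI impI)
        fix k
        assume "k \<le> a"
        then have "path_vertex 0 k \<in> ?V"
          using verts by blast
        then show "y (path_vertex 0 k) = t0 * continuant D0 (Suc a - k)"
          by (simp add: y_def path_vertex_def split: if_splits)
      qed
      have Y1: "\<forall>k\<le>b. y (path_vertex 1 k) = t1 * continuant D1 (Suc b - k)"
      proof (intro allI impI)
        fix k
        assume "k \<le> b"
        then have V: "path_vertex 1 k \<in> ?V"
          using verts by blast
        show "y (path_vertex 1 k) = t1 * continuant D1 (Suc b - k)"
        proof (cases "k = 0")
          case True
          show ?thesis
            unfolding True center y_center e1 p1_def diff_zero by (rule refl)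
        next
          case False
          then show ?thesis
            using V by (simp add: y_def path_vertex_def)
        qed
      qed
      have Y2: "\<forall>k\<le>c. y (path_vertex 2 k) = t2 * continuant D2 (Suc c - k)"
      proof (intro allI impI)
        fix k
        assume "k \<le> c"
        then have V: "path_vertex 2 k \<in> ?V"
          using verts by blast
        show "y (path_vertex 2 k) = t2 * continuant D2 (Suc c - k)"
        proof (cases "k = 0")
          case True
          show ?thesis
            unfolding True center y_center e2 p2_def diff_zero by (rule refl)
        next
          case False
          then show ?thesis
            using V by (simp add: y_def path_vertex_def)
        qed
      qed
      have tips: "y (0, a) = t0" "y (1, b) = t1" "y (2, c) = t2"
        using Y0[rule_format, of a] Y1[rule_format, of b] Y2[rule_format, of c] assms(1-3)
        by (simp_all add: off_center)
      have y1: "y (0, 1) = t0 * continuant D0 a" "y (1, 1) = t1 * continuant D1 b"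
        "y (2, 1) = t2 * continuant D2 c"
        using Y0[rule_format, OF assms(1)] Y1[rule_format, OF assms(2)] Y2[rule_format, OF assms(3)]
        unfolding first by (simp_all only: One_nat_def diff_Suc_Suc diff_zero)
      have "y \<in> ?K"
        unfolding looped_kernel_T_shape_iff[OF assms(1-3)] arms tips y1 y_center
        using C Y0 Y1 Y2 by (simp only: y_def restrict_extensional simp_thms)
      moreover have "?tips y = t"
        unfolding tips t by (rule refl)
      ultimately show ?thesis
        by blast
    qed
    ultimately show "?tips ` ?K = ?S"
      by blast
  qed
  then show ?thesis
    by (rule bij_betw_same_card)
qed

section \<open>The corank for a given loop set\<close>

lemma card_bit_triples:
  "card {(t0 :: bit, t1 :: bit, t2 :: bit). P t0 t1 t2}
    = of_bool (P 0 0 0) + of_bool (P 0 0 1) + of_bool (P 0 1 0) + of_bool (P 0 1 1)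
    + of_bool (P 1 0 0) + of_bool (P 1 0 1) + of_bool (P 1 1 0) + of_bool (P 1 1 1)"
proof -
  let ?U = "UNIV :: bit set"
  have "{(t0, t1, t2). P t0 t1 t2} = (?U \<times> ?U \<times> ?U) \<inter> {t. case t of (t0, t1, t2) \<Rightarrow> P t0 t1 t2}"
    by simp
  also have "card \<dots> = (\<Sum>t\<in>?U \<times> ?U \<times> ?U. of_bool (case t of (t0, t1, t2) \<Rightarrow> P t0 t1 t2))"
    by (subst sum_of_bool_eq) (simp_all add: UNIV_bit del: UNIV_Times_UNIV)
  also have "\<dots> = (\<Sum>t0\<in>?U. \<Sum>t1\<in>?U. \<Sum>t2\<in>?U. of_bool (P t0 t1 t2))"
    by (simp only: sum.cartesian_product case_prod_unfold fst_conv snd_conv)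
  also have "\<dots> = of_bool (P 0 0 0) + of_bool (P 0 0 1) + of_bool (P 0 1 0) + of_bool (P 0 1 1)
    + of_bool (P 1 0 0) + of_bool (P 1 0 1) + of_bool (P 1 1 0) + of_bool (P 1 1 1)"
    by (simp add: UNIV_bit)
  finally show ?thesis .
qed

text \<open>
  Here \<open>p\<close> and \<open>q\<close> are the values that an arm with leaf label \<open>1\<close> gives to the centre and to the
  neighbour of the centre. If no \<open>p\<close> vanishes, the leaf labels are all equal, and the equation at
  the centre decides whether they can be \<open>1\<close>. Otherwise the centre has label \<open>0\<close>; the leaf labels
  of the \<open>m\<close> arms with \<open>p = 0\<close> are free, up to the single equation at the centre, and the other
  leaf labels are \<open>0\<close>.
\<close>
lemma card_gluing_solutions:
  fixes d p0 q0 p1 q1 p2 q2 :: bit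
  assumes "p0 = 0 \<Longrightarrow> q0 = 1" "p1 = 0 \<Longrightarrow> q1 = 1" "p2 = 0 \<Longrightarrow> q2 = 1"
  defines "m \<equiv> of_bool (p0 = 0) + of_bool (p1 = 0) + of_bool (p2 = 0) :: nat"
  shows "card {(t0, t1, t2). t0 * p0 = t1 * p1 \<and> t0 * p0 = t2 * p2 \<and>
      d * (t0 * p0) + (t0 * q0 + (t1 * q1 + t2 * q2)) = 0}
    = (if m = 0 then if d + (q0 + (q1 + q2)) = 0 then 2 else 1 else 2 ^ (m - 1))"
  unfolding card_bit_triples m_def using assms(1-3)
  by (cases p0; cases p1; cases p2) simp_all

lemma corank_T_shape:
  fixes L :: "(nat \<times> nat) set"
  assumes "a \<ge> 1" "b \<ge> 1" "c \<ge> 1" and enum: "vertex_enum vs (T_shape a b c)"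
  defines "D0 \<equiv> arm_loops L 0 a" and "D1 \<equiv> arm_loops L 1 b" and "D2 \<equiv> arm_loops L 2 c"
  defines "m \<equiv> of_bool (continuant D0 (Suc a) = 0) + of_bool (continuant D1 (Suc b) = 0)
    + of_bool (continuant D2 (Suc c) = 0)"
  shows "corank (looped_adj_mat vs (T_shape a b c) L)
    = (if m = 0 then of_bool (of_bool ((0, 0) \<in> L)
          + (continuant D0 a + (continuant D1 b + continuant D2 c)) = 0)
       else m - 1)" (is "?corank = ?r")
proof -
  have "pair_loopfree_digraph (T_shape a b c)"
    using pair_graph_T_shape[of a b c] by (simp add: pair_graph_def pair_digraph_def)
  then have "2 ^ ?corank = card (looped_kernel (T_shape a b c) L)"
    using card_looped_kernel enum by metis
  also have "\<dots> = (if m = 0 then if of_bool ((0, 0) \<in> L)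
        + (continuant D0 a + (continuant D1 b + continuant D2 c)) = 0 then 2 else 1
      else 2 ^ (m - 1))"
    unfolding card_looped_kernel_T_shape[OF assms(1-3)] D0_def[symmetric] D1_def[symmetric]
      D2_def[symmetric] m_def
    by (intro card_gluing_solutions continuant_pred_of_zero)
  also have "\<dots> = 2 ^ ?r"
    by (simp only: of_bool_def split: if_split) simp
  finally show ?thesis
    by (simp only: power_inject_exp one_less_numeral_iff semiring_norm)
qed

section \<open>Summation over all loop sets\<close>

lemma arm_loops_subset: "arm_loops L i l \<subseteq> {1..l}"
  by (auto simp: arm_loops_def)

lemma image_arm_loops: "(\<lambda>j. (i, Suc l - j)) ` arm_loops L i l = L \<inter> Pair i ` {1..l}"
proof -
  have "(i, k) \<in> (\<lambda>j. (i, Suc l - j)) ` arm_loops L i l" if "(i, k) \<in> L" "k \<in> {1..l}" for k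
    using that by (intro image_eqI[of _ _ "Suc l - k"]) (auto simp: arm_loops_def)
  then show ?thesis
    by (auto simp: arm_loops_def intro!: imageI)
qed

lemma arm_loops_image:
  assumes "D \<subseteq> {1..l}" and "\<And>k. 0 < k \<Longrightarrow> (i, k) \<notin> R"
  shows "arm_loops ((\<lambda>j. (i, Suc l - j)) ` D \<union> R) i l = D"
proof -
  have "(i, Suc l - j) \<in> (\<lambda>j. (i, Suc l - j)) ` D \<union> R \<longleftrightarrow> j \<in> D" if j: "j \<in> {1..l}" for j
  proof -
    have "(i, Suc l - j) \<notin> R"
      using j by (intro assms(2)) auto
    moreover have "j = j'" if "Suc l - j = Suc l - j'" "j' \<in> D" for j'
      using that(1) j subsetD[OF assms(1) that(2)] by auto
    ultimately show ?thesis
      by blast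
  qed
  then show ?thesis
    unfolding arm_loops_def using assms(1) by blast
qed

text \<open>
  A loop set on the tree amounts to three independent loop sets on the arms, together with the
  choice of a loop at the centre.
\<close>
lemma sum_Pow_T_shape:
  "(\<Sum>L\<in>Pow (pverts (T_shape a b c)).
      f ((0, 0) \<in> L) (arm_loops L 0 a) (arm_loops L 1 b) (arm_loops L 2 c))
    = (\<Sum>D0\<in>Pow {1..a}. \<Sum>D1\<in>Pow {1..b}. \<Sum>D2\<in>Pow {1..c}. f False D0 D1 D2 + f True D0 D1 D2)"
proof -
  let ?pos = "\<lambda>i l D. (\<lambda>j. (i :: nat, Suc l - j)) ` D"
  let ?split = "\<lambda>L. (arm_loops L 0 a, arm_loops L 1 b, arm_loops L 2 c, (0, 0) \<in> L)"
  let ?join = "\<lambda>(D0, D1, D2, e). ?pos 0 a D0 \<union> (?pos 1 b D1 \<union> (?pos 2 c D2 \<union> (if e then {(0, 0)} else {})))"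
  let ?T = "Pow {1..a} \<times> Pow {1..b} \<times> Pow {1..c} \<times> (UNIV :: bool set)"
  have join_split: "?join (?split L) = L" if "L \<in> Pow (pverts (T_shape a b c))" for L
  proof -
    have "(if (0, 0) \<in> L then {(0, 0)} else {}) = L \<inter> {(0, 0)}"
      by auto
    then have "?join (?split L) = L \<inter> pverts (T_shape a b c)"
      unfolding prod.case image_arm_loops pverts_T_shape by blast
    also have "L \<inter> pverts (T_shape a b c) = L"
      using that by (simp add: Int_absorb2)
    finally show ?thesis .
  qed
  have split_join: "?split (?join t) = t" if t_in: "t \<in> ?T" for t
  proof -
    obtain D0 D1 D2 e where t: "t = (D0, D1, D2, e)"
      by (cases t) auto
    have D: "D0 \<subseteq> {1..a}" "D1 \<subseteq> {1..b}" "D2 \<subseteq> {1..c}"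
      using t_in by (auto simp: t)
    have "arm_loops (?join t) 0 a = D0"
      unfolding t prod.case by (rule arm_loops_image[OF D(1)]) auto
    moreover have "arm_loops (?join t) 1 b = D1"
      unfolding t prod.case Un_left_commute[of _ "?pos 1 b D1"]
      by (rule arm_loops_image[OF D(2)]) auto
    moreover have "arm_loops (?join t) 2 c = D2"
      unfolding t prod.case Un_left_commute[of _ "?pos 2 c D2"]
      by (rule arm_loops_image[OF D(3)]) auto
    moreover have "(0, 0) \<in> ?join t \<longleftrightarrow> e"
      using D by (auto simp: t)
    ultimately show ?thesis
      by (simp only: t)
  qed
  have "(\<Sum>L\<in>Pow (pverts (T_shape a b c)).
      f ((0, 0) \<in> L) (arm_loops L 0 a) (arm_loops L 1 b) (arm_loops L 2 c))
    = (\<Sum>t\<in>?T. (case t of (D0, D1, D2, e) \<Rightarrow> f e D0 D1 D2))"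
  proof (rule sum.reindex_bij_witness[of _ ?join ?split])
    show "?join t \<in> Pow (pverts (T_shape a b c))" if "t \<in> ?T" for t
    proof -
      have "?pos i l D \<subseteq> Pair i ` {1..l}" if "D \<subseteq> {1..l}" for i l D
      proof -
        have "(i, Suc l - j) \<in> Pair i ` {1..l}" if "j \<in> D" for j
          using subsetD[OF \<open>D \<subseteq> {1..l}\<close> that] by (auto intro!: imageI)
        then show ?thesis
          by blast
      qed
      then show ?thesis
        using that unfolding pverts_T_shape by (fastforce split: if_splits)
    qed
    show "?join (?split L) = L" if "L \<in> Pow (pverts (T_shape a b c))" for L
      using that by (rule join_split)
    show "?split (?join t) = t" if "t \<in> ?T" for t
      using that by (rule split_join)
    show "?split L \<in> ?T" for L
      by (intro SigmaI PowI arm_loops_subset UNIV_I)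
    show "(case ?split L of (D0, D1, D2, e) \<Rightarrow> f e D0 D1 D2)
        = f ((0, 0) \<in> L) (arm_loops L 0 a) (arm_loops L 1 b) (arm_loops L 2 c)" for L
      by (simp only: prod.case)
  qed
  also have "\<dots> = (\<Sum>D0\<in>Pow {1..a}. \<Sum>D1\<in>Pow {1..b}. \<Sum>D2\<in>Pow {1..c}. \<Sum>e\<in>UNIV. f e D0 D1 D2)"
    by (simp only: sum.cartesian_product case_prod_unfold fst_conv snd_conv)
  finally show ?thesis
    by (simp only: UNIV_bool) simp
qed

theorem theorem22:
  fixes a b c n :: nat and A B C :: int and vs :: "(nat \<times> nat) list"
  assumes "a \<ge> 1" "b \<ge> 1" "c \<ge> 1"
    and "n = a + b + c + 1"
    and "A = jacobsthal (a + b + 2) * jacobsthal (c + 1)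
             + 2 * jacobsthal (a + 1) * jacobsthal (b + 1) * jacobsthal c"
    and "B = jacobsthal (a + b + 1) * jacobsthal (c + 1)
             + 2 * (jacobsthal a * jacobsthal (b + 1) + jacobsthal (a + 1) * jacobsthal b)
                 * jacobsthal c"
    and "C = 2 * jacobsthal a * jacobsthal b * jacobsthal c"
    and "vertex_enum vs (T_shape a b c)"
  shows "partial_petrial_poly vs (T_shape a b c)
           = monom A n + monom B (n - 1) + monom C (n - 2)"
proof -
  have len: "length vs = n"
    using assms(4,8) distinct_card[of vs] card_pverts_T_shape[of a b c] by (simp add: vertex_enum_def)
  define X :: "nat \<Rightarrow> int poly" where "X k = monom 1 (n - k)" for k
  define zeros where "zeros z0 z1 z2 = of_bool z0 + of_bool z1 + (of_bool z2 :: nat)" for z0 z1 z2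
  \<comment> \<open>The joint contribution of both choices for the loop at the centre.\<close>
  define h where "h z0 z1 z2 = (if zeros z0 z1 z2 = 0 then X 0 + X 1 else 2 * X (zeros z0 z1 z2 - 1))"
    for z0 z1 z2
  define f where "f e D0 D1 D2 =
    (let m = zeros (continuant D0 (Suc a) = 0) (continuant D1 (Suc b) = 0) (continuant D2 (Suc c) = 0)
     in X (if m = 0 then of_bool (of_bool e + (continuant D0 a + (continuant D1 b + continuant D2 c)) = 0)
           else m - 1))" for e D0 D1 D2
  \<comment> \<open>For fixed loops on the arms with no vanishing continuant, toggling the loop at the centre
    toggles the equation there, so each of the coranks 0 and 1 occurs once; otherwise the loop at
    the centre does not affect the corank.\<close>
  have center: "f False D0 D1 D2 + f True D0 D1 D2
      = h (continuant D0 (Suc a) = 0) (continuant D1 (Suc b) = 0) (continuant D2 (Suc c) = 0)"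
    for D0 D1 D2
    by (cases "continuant D0 a + (continuant D1 b + continuant D2 c)")
      (simp_all only: f_def h_def Let_def split: if_split, simp_all)
  have "partial_petrial_poly vs (T_shape a b c)
      = (\<Sum>L\<in>Pow (pverts (T_shape a b c)).
          f ((0, 0) \<in> L) (arm_loops L 0 a) (arm_loops L 1 b) (arm_loops L 2 c))"
    unfolding partial_petrial_poly_def f_def Let_def zeros_def X_def len
      corank_T_shape[OF assms(1-3,8)] by (rule refl)
  also have "\<dots> = (\<Sum>D0\<in>Pow {1..a}. \<Sum>D1\<in>Pow {1..b}. \<Sum>D2\<in>Pow {1..c}.
      h (continuant D0 (Suc a) = 0) (continuant D1 (Suc b) = 0) (continuant D2 (Suc c) = 0))"
    unfolding sum_Pow_T_shape center by (rule refl)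
  also have "\<dots> = (\<Sum>D0\<in>Pow {1..a}. \<Sum>D1\<in>Pow {1..b}.
      of_int (jacobsthal c) * h (continuant D0 (Suc a) = 0) (continuant D1 (Suc b) = 0) True
      + of_int (jacobsthal (Suc c)) * h (continuant D0 (Suc a) = 0) (continuant D1 (Suc b) = 0) False)"
    by (intro sum.cong refl sum_continuant)
  also have "\<dots> = (\<Sum>D0\<in>Pow {1..a}.
      of_int (jacobsthal b) * (of_int (jacobsthal c) * h (continuant D0 (Suc a) = 0) True True
        + of_int (jacobsthal (Suc c)) * h (continuant D0 (Suc a) = 0) True False)
      + of_int (jacobsthal (Suc b)) * (of_int (jacobsthal c) * h (continuant D0 (Suc a) = 0) False True
        + of_int (jacobsthal (Suc c)) * h (continuant D0 (Suc a) = 0) False False))"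
    by (intro sum.cong refl sum_continuant[where h = "\<lambda>z. of_int (jacobsthal c) * h _ z True
      + of_int (jacobsthal (Suc c)) * h _ z False"])
  also have "\<dots> = of_int (jacobsthal a) * (of_int (jacobsthal b) * (of_int (jacobsthal c) * h True True True
        + of_int (jacobsthal (Suc c)) * h True True False)
      + of_int (jacobsthal (Suc b)) * (of_int (jacobsthal c) * h True False True
        + of_int (jacobsthal (Suc c)) * h True False False))
      + of_int (jacobsthal (Suc a)) * (of_int (jacobsthal b) * (of_int (jacobsthal c) * h False True True
        + of_int (jacobsthal (Suc c)) * h False True False)
      + of_int (jacobsthal (Suc b)) * (of_int (jacobsthal c) * h False False True
        + of_int (jacobsthal (Suc c)) * h False False False))"
    by (rule sum_continuant[where h = "\<lambda>z. of_int (jacobsthal b) * (of_int (jacobsthal c) * h z True True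
        + of_int (jacobsthal (Suc c)) * h z True False)
      + of_int (jacobsthal (Suc b)) * (of_int (jacobsthal c) * h z False True
        + of_int (jacobsthal (Suc c)) * h z False False)"])
  also have "\<dots> = of_int A * X 0 + of_int B * X 1 + of_int C * X 2"
  proof -
    have "jacobsthal (a + b + 2) = jacobsthal (Suc (Suc a)) * jacobsthal (Suc b)
        + 2 * jacobsthal (Suc a) * jacobsthal b"
      using jacobsthal_add[of "Suc a" b] by simp
    then have A: "A = (jacobsthal (Suc (Suc a)) * jacobsthal (Suc b) + 2 * jacobsthal (Suc a) * jacobsthal b)
        * jacobsthal (Suc c) + 2 * jacobsthal (Suc a) * jacobsthal (Suc b) * jacobsthal c"
      using assms(5) by (simp only: Suc_eq_plus1)
    have "jacobsthal (a + b + 1) = jacobsthal (Suc a) * jacobsthal (Suc b) + 2 * jacobsthal a * jacobsthal b"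
      using jacobsthal_add[of a b] by simp
    then have B: "B = (jacobsthal (Suc a) * jacobsthal (Suc b) + 2 * jacobsthal a * jacobsthal b)
        * jacobsthal (Suc c) + 2 * (jacobsthal a * jacobsthal (Suc b) + jacobsthal (Suc a) * jacobsthal b)
        * jacobsthal c"
      using assms(6) by (simp only: Suc_eq_plus1)
    show ?thesis
      unfolding A B assms(7) h_def zeros_def by (simp add: algebra_simps numeral_2_eq_2)
  qed
  also have "\<dots> = monom A n + monom B (n - 1) + monom C (n - 2)"
    by (simp add: X_def of_int_poly smult_monom)
  finally show ?thesis .
qed

end
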